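(* For every positive integer $r$, $\delta(23r)\ge 8r$. Consequently $\liminf_{n\to\infty} \delta(n)/n \ge 8/23$.
   Context: A double-$n$ string is a string of length $2n$ over an alphabet of $n$ symbols in which each symbol appears exactly twice. Positions in the string are numbered $1,\dots,2n$. The distance between two distinct symbols is the minimum, over an occurrence of the first symbol and an occurrence of the second, of the absolute difference of their positions. The diameter of a double-$n$ string ($n\ge 2$) is the maximum of the distance over all pairs of distinct symbols. $\delta(n)$ denotes the minimum diameter over all double-$n$ strings. *)

theory Defs
  imports "HOL-Analysis.Analysis"
begin

text \<open>A double-n string: a map from positions 1..2n to symbols 1..n where each
symbol occurs exactly twice. Positions outside 1..2n are irrelevant; we normalise
them to 0 so that the set of strings is finite.\<close>
definition double_string :: "nat \<Rightarrow> (nat \<Rightarrow> nat) \<Rightarrow> bool" where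
  "double_string n s \<longleftrightarrow>
     (\<forall>i\<in>{1..2*n}. s i \<in> {1..n}) \<and>
     (\<forall>i. i \<notin> {1..2*n} \<longrightarrow> s i = 0) \<and>
     (\<forall>a\<in>{1..n}. card {i\<in>{1..2*n}. s i = a} = 2)"

definition sym_dist :: "nat \<Rightarrow> (nat \<Rightarrow> nat) \<Rightarrow> nat \<Rightarrow> nat \<Rightarrow> nat" where
  "sym_dist n s a b =
     Min {nat \<bar>int i - int j\<bar> | i j. i \<in> {1..2*n} \<and> j \<in> {1..2*n} \<and> s i = a \<and> s j = b}"

definition diameter :: "nat \<Rightarrow> (nat \<Rightarrow> nat) \<Rightarrow> nat" where
  "diameter n s = Max {sym_dist n s a b | a b. a \<in> {1..n} \<and> b \<in> {1..n} \<and> a \<noteq> b}"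

definition delta :: "nat \<Rightarrow> nat" where
  "delta n = Min {diameter n s | s. double_string n s}"

end

theory Submission
  imports Defs
begin

text \<open>Let \<open>p\<close> be the involution exchanging the two occurrences of each symbol, let \<open>D\<close> be the
  diameter plus one, assume \<open>23 D \<le> 8 n\<close>, and put \<open>e = 3 D - n \<le> D / 8\<close>. For a position \<open>i \<le> D\<close> the
  positions within distance less than \<open>D\<close> of \<open>i\<close> or \<open>p i\<close> contain every symbol, but there are at most
  \<open>i + 3 D - 2\<close> of them, so at most \<open>i + e - 2\<close> of the positions \<open>j \<le> D\<close> have \<open>p j\<close> close to \<open>p i\<close>. Hence
  positions \<open>1\<close> and some \<open>x \<le> e\<close> have partners at least \<open>D\<close> apart, and the same holds at the right end
  of the string. These four partners cannot all be close across the two ends, so, up to reflection,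
  \<open>p 1\<close> or \<open>p x\<close> lies near the right end. Greedily choosing further small positions whose partners
  are pairwise at least \<open>D\<close> apart then leaves too little room for all partners of \<open>1, \<dots>, D\<close>.\<close>

section \<open>Pairings of positions and the size of neighbourhoods\<close>

text \<open>Keeps only the pairing of positions, over \<open>int\<close> so that subtraction is not
  truncated. The assumptions are to be refuted; \<open>D_small\<close> is the negation of the
  desired bound.\<close>

locale close_matching =
  fixes n D :: int and p :: "int \<Rightarrow> int"
  assumes D_pos: "1 \<le> D"
    and D_small: "23 * D \<le> 8 * n"
    and p_range: "i \<in> {1..2*n} \<Longrightarrow> p i \<in> {1..2*n}"
    and p_invol: "i \<in> {1..2*n} \<Longrightarrow> p (p i) = i"
    and p_neq: "i \<in> {1..2*n} \<Longrightarrow> p i \<noteq> i"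
    and p_near: "\<lbrakk>i \<in> {1..2*n}; j \<in> {1..2*n}; j \<noteq> i; j \<noteq> p i\<rbrakk> \<Longrightarrow>
      \<bar>i - j\<bar> < D \<or> \<bar>i - p j\<bar> < D \<or> \<bar>p i - j\<bar> < D \<or> \<bar>p i - p j\<bar> < D"
begin

definition nbhd :: "int \<Rightarrow> int set" where
  "nbhd i = {j \<in> {1..2*n}. \<bar>j - i\<bar> < D \<or> \<bar>j - p i\<bar> < D}"

text \<open>For \<open>i\<close> in \<open>{1..D}\<close> the restriction to \<open>{1..D}\<close>
  puts every member within distance less than \<open>D\<close> of \<open>i\<close>.\<close>

definition cluster :: "int \<Rightarrow> int set" where
  "cluster i = {j \<in> {1..D}. \<bar>p j - p i\<bar> < D}"

lemma finite_nbhd [simp]: "finite (nbhd i)"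
  by (rule finite_subset[of _ "{1..2*n}"]) (auto simp: nbhd_def)

lemma finite_cluster [simp]: "finite (cluster i)"
  by (rule finite_subset[of _ "{1..D}"]) (auto simp: cluster_def)

lemma inj_on_p: "S \<subseteq> {1..2*n} \<Longrightarrow> inj_on p S"
  by (metis inj_onI p_invol subsetD)

text \<open>The complement of a neighbourhood is mapped by \<open>p\<close> into the neighbourhood, avoiding the
  pairs that lie entirely inside it.\<close>
lemma card_nbhd_ge:
  assumes i: "i \<in> {1..2*n}" and T: "T \<subseteq> nbhd i" "p ` T \<subseteq> nbhd i"
  shows "2 * int (card (nbhd i)) \<ge> 2 * n + int (card T)"
proof -
  let ?C = "{1..2*n} - nbhd i"
  have "p ` ?C \<subseteq> nbhd i - T"
  proof clarify
    fix c assume c: "c \<in> {1..2*n}" "c \<notin> nbhd i"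
    have "c \<noteq> i" "c \<noteq> p i"
      using c D_pos by (auto simp: nbhd_def)
    then have "\<bar>i - p c\<bar> < D \<or> \<bar>p i - p c\<bar> < D"
      using p_near[OF i c(1)] c by (auto simp: nbhd_def)
    then have "p c \<in> nbhd i"
      using p_range[OF c(1)] by (auto simp: nbhd_def)
    moreover have "p c \<notin> T"
      using T(2) c p_invol[OF c(1)] by force
    ultimately show "p c \<in> nbhd i - T" by blast
  qed
  then have "card (p ` ?C) \<le> card (nbhd i - T)"
    by (intro card_mono) auto
  moreover have "card (p ` ?C) = card ?C"
    by (intro card_image inj_on_p) auto
  moreover have "card (nbhd i - T) = card (nbhd i) - card T" "card T \<le> card (nbhd i)"
    using T(1) by (auto intro!: card_Diff_subset card_mono intro: finite_subset)
  moreover have sub: "nbhd i \<subseteq> {1..2*n}" by (auto simp: nbhd_def)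
  moreover have "card ?C = card {1..2*n} - card (nbhd i)" "card (nbhd i) \<le> card {1..2*n}"
    using sub by (intro card_Diff_subset card_mono; simp)+
  ultimately show ?thesis
    using i by simp
qed

text \<open>Taking \<open>{i, p i}\<close> as \<open>T\<close> gives \<open>nbhd i\<close> at least
  \<open>n + 1\<close> elements, which a smaller \<open>p i\<close> leaves no room for.\<close>

lemma partner_ge:
  assumes "i \<in> {1..D}"
  shows "p i \<ge> n - D + 2"
proof -
  have i: "i \<in> {1..2*n}" using assms D_small D_pos by auto
  note pi = p_range[OF i] p_neq[OF i]
  have "2 * int (card (nbhd i)) \<ge> 2 * n + int (card {i, p i})"
    by (intro card_nbhd_ge) (use i pi p_invol[OF i] D_pos in \<open>auto simp: nbhd_def\<close>)
  moreover have "card (nbhd i) \<le> card {1..max i (p i) + D - 1}"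
    by (intro card_mono) (auto simp: nbhd_def)
  ultimately show ?thesis
    using pi assms D_small D_pos by (auto simp: max_def split: if_splits)
qed

text \<open>The cluster and its image under \<open>p\<close> are disjoint, and their union, closed
  under \<open>p\<close>, serves as \<open>T\<close>.\<close>

lemma card_cluster_nbhd:
  assumes "i \<in> {1..D}"
  shows "n + int (card (cluster i)) \<le> int (card (nbhd i))"
proof -
  have D: "{1..D} \<subseteq> {1..2*n}" using D_small D_pos by auto
  let ?B = "cluster i"
  have B: "?B \<subseteq> {1..D}" by (auto simp: cluster_def)
  have disj: "?B \<inter> p ` ?B = {}"
    using B partner_ge D_small by (force simp: cluster_def)
  have "card (?B \<union> p ` ?B) = card ?B + card (p ` ?B)"
    by (intro card_Un_disjoint disj) auto
  moreover have "card (p ` ?B) = card ?B"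
    using B D by (intro card_image inj_on_p) auto
  moreover have "2 * int (card (nbhd i)) \<ge> 2 * n + int (card (?B \<union> p ` ?B))"
  proof (intro card_nbhd_ge)
    show "i \<in> {1..2*n}" using assms D by auto
    have 1: "?B \<subseteq> nbhd i" using assms D by (auto simp: cluster_def nbhd_def)
    have 2: "p ` ?B \<subseteq> nbhd i" using p_range D by (force simp: cluster_def nbhd_def)
    have 3: "p ` p ` ?B = ?B" using B D p_invol by (force simp: image_image)
    show "?B \<union> p ` ?B \<subseteq> nbhd i" "p ` (?B \<union> p ` ?B) \<subseteq> nbhd i"
      using 1 2 3 by (auto simp: image_Un)
  qed
  ultimately show ?thesis by simp
qed

lemma card_cluster_pos:
  assumes "i \<in> {1..D}"
  shows "1 \<le> int (card (cluster i))"
proof -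
  have "i \<in> cluster i" using assms by (auto simp: cluster_def)
  then have "cluster i \<noteq> {}" by blast
  then show ?thesis by (simp add: Suc_le_eq card_gt_0_iff)
qed

text \<open>Three ways to enclose \<open>nbhd i\<close>: with a full window around
  \<open>p i\<close>, with that window cut off at the right end, and by one initial segment.\<close>

lemma card_cluster_le:
  assumes i: "i \<in> {1..D}"
  shows "int (card (cluster i)) \<le> i + 3 * D - 2 - n"
    and "int (card (cluster i)) \<le> i + n + 2 * D - 1 - p i"
    and "int (card (cluster i)) \<le> p i + D - 1 - n"
proof -
  have pi: "n - D + 2 \<le> p i" "p i \<le> 2 * n"
    using partner_ge[OF i] p_range[of i] i D_small D_pos by auto
  have "card (nbhd i) \<le> card ({1..i+D-1} \<union> {p i - D + 1..p i + D - 1})"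
    by (intro card_mono) (auto simp: nbhd_def)
  also have "\<dots> \<le> card {1..i+D-1} + card {p i - D + 1..p i + D - 1}"
    by (rule card_Un_le)
  finally show "int (card (cluster i)) \<le> i + 3 * D - 2 - n"
    using card_cluster_nbhd[OF i] i D_pos by auto
  have "card (nbhd i) \<le> card ({1..i+D-1} \<union> {p i - D + 1..2 * n})"
    by (intro card_mono) (auto simp: nbhd_def)
  also have "\<dots> \<le> card {1..i+D-1} + card {p i - D + 1..2 * n}"
    by (rule card_Un_le)
  finally show "int (card (cluster i)) \<le> i + n + 2 * D - 1 - p i"
    using card_cluster_nbhd[OF i] i pi D_pos by auto
  have "card (nbhd i) \<le> card {1..p i + D - 1}"
    using i pi D_small by (intro card_mono) (auto simp: nbhd_def)
  then show "int (card (cluster i)) \<le> p i + D - 1 - n"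
    using card_cluster_nbhd[OF i] i pi D_small by simp
qed

section \<open>Positions with far partners\<close>

lemma ex_small_notin:
  assumes "finite S" "int (card S) \<le> k" "k < D" "0 \<le> k"
  obtains x where "x \<in> {1..D}" "x \<notin> S" "x \<le> k + 1"
proof -
  have "\<not> {1..k+1} \<subseteq> S"
    using card_mono[OF assms(1), of "{1..k+1}"] assms by auto
  then obtain x where "x \<in> {1..k+1}" "x \<notin> S" by blast
  with assms show ?thesis by (intro that) auto
qed

lemma ex_far:
  obtains x where "x \<in> {1..D}" "x \<le> 3 * D - n" "D \<le> \<bar>p x - p 1\<bar>"
proof -
  have 1: "1 \<in> {1..D}" using D_pos by simp
  obtain x where "x \<in> {1..D}" "x \<notin> cluster 1" "x \<le> 3 * D - n - 1 + 1"
    by (rule ex_small_notin[of "cluster 1" "3 * D - n - 1"])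
       (use card_cluster_le(1)[OF 1] card_cluster_pos[OF 1] D_small in auto)
  then show ?thesis by (intro that[of x]) (auto simp: cluster_def)
qed


text \<open>If \<open>p a\<close> is at most \<open>5 D - e\<close>, partners far from those of \<open>a\<close>, \<open>b\<close> and a third position \<open>x\<close> are
  squeezed into the last \<open>e - 1\<close> places. If \<open>p a = 5 D - e + t\<close> with \<open>t > 0\<close>, the neighbourhood of \<open>p a\<close>
  overhangs the right end, which shrinks the cluster of \<open>a\<close>; among \<open>b\<close>, \<open>x\<close> and a fourth position
  \<open>y\<close> the one with the leftmost partner has a cluster smaller than \<open>t\<close>, and a fifth position \<open>z\<close>
  with a far partner still exists although there is no place for it.\<close>
lemma partner_not_high:
  assumes ab: "a \<in> {1..D}" "b \<in> {1..D}" "a = 1 \<or> b = 1" "a \<le> 3 * D - n" "b \<le> 3 * D - n"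
    and far: "D \<le> \<bar>p a - p b\<bar>"
  shows "p a < 3 * n - 4 * D + 2"
proof (rule ccontr)
  assume "\<not> ?thesis"
  then have high: "p a \<ge> 3 * n - 4 * D + 2" by simp
  let ?c = "\<lambda>i. int (card (cluster i))"
  define e where "e = 3 * D - n"
  have n: "n = 3 * D - e" and e: "8 * e \<le> D"
    using D_small by (auto simp: e_def)
  have cl: "?c i \<le> i + e - 2" "?c i \<le> i + 5 * D - e - 1 - p i" "?c i \<le> p i - 2 * D + e - 1"
    "1 \<le> ?c i" "p i \<le> 6 * D - 2 * e" if "i \<in> {1..D}" for i
    using card_cluster_le[OF that] card_cluster_pos[OF that] p_range[of i] that e
    by (auto simp: n)
  have not_cluster: "D \<le> \<bar>p j - p i\<bar>" if "j \<in> {1..D}" "j \<notin> cluster i" for i j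
    using that by (auto simp: cluster_def)
  note a = cl[OF ab(1)] and b = cl[OF ab(2)]
  let ?S2 = "cluster a \<union> cluster b"
  have S2: "int (card ?S2) \<le> ?c a + ?c b"
    using card_Un_le[of "cluster a" "cluster b"] by simp
  have ab_le: "a \<le> e" "b \<le> e" using ab by (auto simp: e_def)
  have S2_lt: "?c a + ?c b < D" using a(1) b(1) ab_le e ab(1) by auto
  obtain x where x: "x \<in> {1..D}" "x \<notin> ?S2" "x \<le> ?c a + ?c b + 1"
    by (rule ex_small_notin[OF _ S2 S2_lt]) auto
  note cx = cl[OF x(1)]
  have xa: "D \<le> \<bar>p x - p a\<bar>" and xb: "D \<le> \<bar>p x - p b\<bar>"
    using x not_cluster by auto
  let ?S3 = "?S2 \<union> cluster x"
  have S3: "int (card ?S3) \<le> ?c a + ?c b + ?c x"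
    using card_Un_le[of ?S2 "cluster x"] S2 by simp
  show False
  proof (cases "p a \<le> 5 * D - e")
    case True
    have "p ` ({1..D} - ?S3) \<subseteq> {6 * D - 3 * e + 2..6 * D - 2 * e}"
    proof (rule image_subsetI)
      fix j assume "j \<in> {1..D} - ?S3"
      then have j: "j \<in> {1..D}" "j \<notin> ?S3" by auto
      then have ja: "D \<le> \<bar>p j - p a\<bar>" and jb: "D \<le> \<bar>p j - p b\<bar>" and jx: "D \<le> \<bar>p j - p x\<bar>"
        using not_cluster by auto
      have split: "p i \<le> 4 * D - e \<or> p i \<ge> 6 * D - 3 * e + 2" if "D \<le> \<bar>p i - p a\<bar>" for i
        using that True high n by linarith
      have "x \<le> 3 * e - 2"
        using x(3) a(1) b(1) ab(3) ab_le by linarith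
      then have "p b \<le> 4 * D - e" "p x \<le> 4 * D - e"
        using split[of b] split[OF xa] far b(2,4) cx(2,4) ab_le e by linarith+
      \<comment> \<open>\<open>p b\<close> and \<open>p x\<close> are at least \<open>D\<close>
        apart in a stretch of \<open>2 * D - 1\<close> places, which cannot hold a third such
        value.\<close>
      moreover have "2 * D - e + 2 \<le> p b" "2 * D - e + 2 \<le> p x" "2 * D - e + 2 \<le> p j"
        using b(3,4) cx(3,4) cl(3,4)[OF j(1)] by linarith+
      ultimately have "\<not> p j \<le> 4 * D - e"
        using xb jb jx by linarith
      then show "p j \<in> {6 * D - 3 * e + 2..6 * D - 2 * e}"
        using split[OF ja] cl(5)[OF j(1)] by auto
    qed
    then have "card (p ` ({1..D} - ?S3)) \<le> card {6 * D - 3 * e + 2..6 * D - 2 * e}"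
      by (intro card_mono) auto
    moreover have "card (p ` ({1..D} - ?S3)) = card ({1..D} - ?S3)"
      using e n D_pos by (intro card_image inj_on_p) auto
    moreover have "int (card ({1..D} - ?S3)) \<ge> D - int (card ?S3)"
      using diff_card_le_card_Diff[of ?S3 "{1..D}"] by simp
    moreover have "e \<ge> 2"
      using a ab cl[of 1] D_pos by auto
    \<comment> \<open>At most \<open>7 * e - 7\<close> positions of \<open>{1..D}\<close> lie in
      \<open>?S3\<close> and at most \<open>e - 1\<close> outside it, but
      \<open>8 * e \<le> D\<close>.\<close>
    ultimately show False
      using S3 a(1) b(1) cx(1) ab(3) ab_le x(3) e by auto
  next
    case False
    define t where "t = p a - 5 * D + e"
    have t: "p a = 5 * D - e + t" "1 \<le> t"
      using False by (auto simp: t_def)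
    \<comment> \<open>For \<open>a = 1\<close> the cut-off window would contradict that
      \<open>cluster a\<close> is nonempty.\<close>
    have b1: "b = 1"
      using ab(3) a t by auto
    have S3_lt: "?c a + ?c b + ?c x < D"
      using a(1) b(1) b1 ab_le cx(1) x(3) e by linarith
    obtain y where y: "y \<in> {1..D}" "y \<notin> ?S3" "y \<le> ?c a + ?c b + ?c x + 1"
      by (rule ex_small_notin[OF _ S3 S3_lt]) auto
    note cy = cl[OF y(1)]
    have ya: "D \<le> \<bar>p y - p a\<bar>" and yb: "D \<le> \<bar>p y - p b\<bar>" and yx: "D \<le> \<bar>p y - p x\<bar>"
      using y not_cluster by auto
    let ?S4 = "?S3 \<union> cluster y"
    have S4: "int (card ?S4) \<le> ?c a + ?c b + ?c x + ?c y"
      using card_Un_le[of ?S3 "cluster y"] S3 by simp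
    have low: "p j \<le> 4 * D - e + t" if "j \<in> {1..D}" "D \<le> \<bar>p j - p a\<bar>" for j
      using cl(5)[OF that(1)] that(2) t a(1,4) ab_le(1) by linarith
    have lows: "p b \<le> 4 * D - e + t" "p x \<le> 4 * D - e + t" "p y \<le> 4 * D - e + t"
      using low[OF ab(2)] low[OF x(1) xa] low[OF y(1) ya] far by (auto simp: abs_minus_commute)
    \<comment> \<open>The least of three values pairwise \<open>D\<close> apart is at least
      \<open>2 * D\<close> below their common upper bound.\<close>
    have "p b \<le> 2 * D - e + t \<or> p x \<le> 2 * D - e + t \<or> p y \<le> 2 * D - e + t"
      using lows xb yb yx by linarith
    then have "?c b \<le> t - 1 \<or> ?c x \<le> t - 1 \<or> ?c y \<le> t - 1"
      using b(3) cx(3) cy(3) by linarith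
    moreover have "?c a \<le> e - 1 - t" "?c b \<le> e - 1" "?c x \<le> ?c a + ?c b + e - 1"
      "?c y \<le> ?c a + ?c b + ?c x + e - 1"
      using a(2) b(1) b1 cx(1) cy(1) x(3) y(3) t(1) ab_le by linarith+
    \<comment> \<open>In each case the \<open>- t\<close> in the bound for \<open>?c a\<close>
      offsets the \<open>t - 1\<close> of the small cluster, and the total stays below
      \<open>7 * e\<close>.\<close>
    ultimately have S4_lt: "?c a + ?c b + ?c x + ?c y < D"
      using t(2) e D_pos by linarith
    obtain z where z: "z \<in> {1..D}" "z \<notin> ?S4"
      by (rule ex_small_notin[OF _ S4 S4_lt]) auto
    have za: "D \<le> \<bar>p z - p a\<bar>" and zb: "D \<le> \<bar>p z - p b\<bar>" and zx: "D \<le> \<bar>p z - p x\<bar>"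
      using z not_cluster by auto
    have zy: "D \<le> \<bar>p z - p y\<bar>"
      using z not_cluster by auto
    have "2 * D - e + 2 \<le> p b" "2 * D - e + 2 \<le> p x" "2 * D - e + 2 \<le> p y" "2 * D - e + 2 \<le> p z"
      using b(3,4) cx(3,4) cy(3,4) cl(3,4)[OF z(1)] by linarith+
    moreover have "t \<le> e"
      using a(2,4) t(1) ab_le by linarith
    \<comment> \<open>Four values pairwise \<open>D\<close> apart span at least
      \<open>3 * D\<close>, but their range has length only \<open>2 * D - 2 + t\<close>.\<close>
    ultimately show False
      using lows low[OF z(1) za] xb yb yx zb zx zy e by linarith
  qed
qed

section \<open>Confronting the two ends of the string\<close>

lemma close_matching_reflect:
  "close_matching n D (\<lambda>i. 2 * n + 1 - p (2 * n + 1 - i))"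
proof
  fix i assume i: "i \<in> {1..2*n}"
  then have i': "2 * n + 1 - i \<in> {1..2*n}" by auto
  show "2 * n + 1 - p (2 * n + 1 - i) \<in> {1..2*n}"
    using p_range[OF i'] by auto
  show "2 * n + 1 - p (2 * n + 1 - (2 * n + 1 - p (2 * n + 1 - i))) = i"
    using p_invol[OF i'] by auto
  show "2 * n + 1 - p (2 * n + 1 - i) \<noteq> i"
    using p_neq[OF i'] by auto
  fix j assume j: "j \<in> {1..2*n}" "j \<noteq> i" "j \<noteq> 2 * n + 1 - p (2 * n + 1 - i)"
  then have "2 * n + 1 - j \<in> {1..2*n}" by auto
  from p_near[OF i' this] j
  show "\<bar>i - j\<bar> < D \<or> \<bar>i - (2 * n + 1 - p (2 * n + 1 - j))\<bar> < D \<or>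
      \<bar>2 * n + 1 - p (2 * n + 1 - i) - j\<bar> < D \<or>
      \<bar>2 * n + 1 - p (2 * n + 1 - i) - (2 * n + 1 - p (2 * n + 1 - j))\<bar> < D"
    by (auto simp: abs_minus_commute algebra_simps)
qed (use D_pos D_small in auto)

lemma inconsistent: False
proof -
  interpret R: close_matching n D "\<lambda>i. 2 * n + 1 - p (2 * n + 1 - i)"
    by (rule close_matching_reflect)
  have 1: "1 \<in> {1..D}" using D_pos by simp
  obtain x where x: "x \<in> {1..D}" "x \<le> 3 * D - n" "D \<le> \<bar>p x - p 1\<bar>"
    by (rule ex_far)
  obtain y where y: "y \<in> {1..D}" "y \<le> 3 * D - n"
      "D \<le> \<bar>2 * n + 1 - p (2 * n + 1 - y) - (2 * n + 1 - p (2 * n + 1 - 1))\<bar>"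
    by (rule R.ex_far)
  \<comment> \<open>Either order of the pair is admissible, so both partners are bounded.\<close>
  have pi: "p i < 3 * n - 4 * D + 2" if "i \<in> {1, x}" for i
    using partner_not_high[of 1 x] partner_not_high[of x 1] that x 1 by auto
  have pj: "2 * n + 1 - p (2 * n + 1 - j) < 3 * n - 4 * D + 2" if "j \<in> {1, y}" for j
    using R.partner_not_high[of 1 y] R.partner_not_high[of y 1] that y 1 by auto
  have near: "\<bar>p i - p (2 * n + 1 - j)\<bar> < D" if ij: "i \<in> {1, x}" "j \<in> {1, y}" for i j
  proof -
    have b: "1 \<le> i" "i \<le> 3 * D - n" "1 \<le> j" "j \<le> 3 * D - n"
      using ij x y by auto
    have "i \<in> {1..2*n}" "2 * n + 1 - j \<in> {1..2*n}" "2 * n + 1 - j \<noteq> i" "2 * n + 1 - j \<noteq> p i"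
      using b D_small D_pos pi[OF ij(1)] by auto
    \<comment> \<open>The constant \<open>3 * n - 4 * D + 2\<close> is just what keeps
      \<open>p i\<close> at least \<open>D\<close> away from the right-end position, and
      symmetrically; only the two partners can be close.\<close>
    from p_near[OF this] show ?thesis
      using b D_small D_pos pi[OF ij(1)] pj[OF ij(2)] by linarith
  qed
  \<comment> \<open>Values close to both of two points at least \<open>D\<close> apart lie in an
    open interval of length at most \<open>D\<close>, so two of them cannot be \<open>D\<close>
    apart.\<close>
  show False
    using near[of 1 1] near[of 1 y] near[of x 1] near[of x y] x y by auto
qed

end

section \<open>From strings to pairings\<close>

lemma double_string_partner:
  assumes s: "double_string n s" and i: "i \<in> {1..2*n}"
  obtains j where "j \<in> {1..2*n}" "j \<noteq> i" "\<And>k. k \<in> {1..2*n} \<Longrightarrow> s k = s i \<longleftrightarrow> k = i \<or> k = j"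
proof -
  have "card {k\<in>{1..2*n}. s k = s i} = 2"
    using s i by (simp add: double_string_def)
  then obtain u v where uv: "{k\<in>{1..2*n}. s k = s i} = {u, v}" "u \<noteq> v"
    by (auto simp: card_2_iff)
  moreover have "i \<in> {k\<in>{1..2*n}. s k = s i}" using i by simp
  ultimately obtain j where j: "{k\<in>{1..2*n}. s k = s i} = {i, j}" "j \<noteq> i"
    by (cases "i = u") auto
  show thesis
  proof
    show "j \<in> {1..2*n}" using j(1) by blast
    show "s k = s i \<longleftrightarrow> k = i \<or> k = j" if "k \<in> {1..2*n}" for k
      using j(1) that by blast
  qed (rule j(2))
qed

lemma finite_sym_dist_image:
  "finite {sym_dist n s a b | a b. a \<in> {1..n} \<and> b \<in> {1..n} \<and> a \<noteq> b}"
proof (rule finite_subset)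
  show "{sym_dist n s a b | a b. a \<in> {1..n} \<and> b \<in> {1..n} \<and> a \<noteq> b}
      \<subseteq> (\<lambda>(a, b). sym_dist n s a b) ` ({1..n} \<times> {1..n})" by auto
qed simp

lemma diameter_witness:
  assumes s: "double_string n s" and ij: "i \<in> {1..2*n}" "j \<in> {1..2*n}" "s i \<noteq> s j"
  obtains k l where "k \<in> {1..2*n}" "l \<in> {1..2*n}" "s k = s i" "s l = s j"
    "\<bar>int k - int l\<bar> \<le> int (diameter n s)"
proof -
  let ?A = "{nat \<bar>int k - int l\<bar> | k l. k \<in> {1..2*n} \<and> l \<in> {1..2*n} \<and> s k = s i \<and> s l = s j}"
  have "?A \<subseteq> (\<lambda>(k, l). nat \<bar>int k - int l\<bar>) ` ({1..2*n} \<times> {1..2*n})" by auto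
  then have "finite ?A" by (rule finite_subset) simp
  moreover have "?A \<noteq> {}" using ij by blast
  ultimately have "sym_dist n s (s i) (s j) \<in> ?A"
    unfolding sym_dist_def by (rule Min_in)
  then obtain k l where kl: "k \<in> {1..2*n}" "l \<in> {1..2*n}" "s k = s i" "s l = s j"
      "sym_dist n s (s i) (s j) = nat \<bar>int k - int l\<bar>"
    by blast
  have "s i \<in> {1..n}" "s j \<in> {1..n}"
    using s ij by (auto simp: double_string_def)
  then have "sym_dist n s (s i) (s j) \<le> diameter n s"
    unfolding diameter_def using ij(3) by (intro Max_ge finite_sym_dist_image) blast
  with kl show thesis by (intro that[of k l]) auto
qed

lemma diameter_bound:
  assumes s: "double_string n s"
  shows "8 * n < 23 * (diameter n s + 1)"
proof (rule ccontr)
  assume small: "\<not> ?thesis"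
  have "\<forall>i\<in>{1..2*n}. \<exists>j\<in>{1..2*n}. j \<noteq> i \<and> (\<forall>k\<in>{1..2*n}. s k = s i \<longleftrightarrow> k = i \<or> k = j)"
    by (metis double_string_partner[OF s])
  then obtain q where q: "\<And>i. i \<in> {1..2*n} \<Longrightarrow> q i \<in> {1..2*n} \<and> q i \<noteq> i"
    and q_iff: "\<And>i k. \<lbrakk>i \<in> {1..2*n}; k \<in> {1..2*n}\<rbrakk> \<Longrightarrow> s k = s i \<longleftrightarrow> k = i \<or> k = q i"
    by metis
  have q_invol: "q (q i) = i" if "i \<in> {1..2*n}" for i
    using q[OF that] q[of "q i"] q_iff[OF that, of "q i"] q_iff[of "q i" i] that by auto
  have pos: "nat i \<in> {1..2*n}" if "i \<in> {1..2*int n}" for i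
    using that by auto
  \<comment> \<open>The added \<open>1\<close> turns distance at most the diameter into distance
    strictly less than \<open>D\<close>.\<close>
  interpret close_matching "int n" "int (diameter n s + 1)" "\<lambda>i. int (q (nat i))"
  proof
    fix i assume "i \<in> {1..2*int n}"
    note i = this pos[OF this]
    show "int (q (nat i)) \<in> {1..2*int n}" using q[OF i(2)] by auto
    show "int (q (nat (int (q (nat i))))) = i" using q_invol[OF i(2)] i(1) by auto
    show "int (q (nat i)) \<noteq> i" using q[OF i(2)] by auto
    fix j assume "j \<in> {1..2*int n}" and ne: "j \<noteq> i" "j \<noteq> int (q (nat i))"
    note j = this(1) pos[OF this(1)]
    have "s (nat j) \<noteq> s (nat i)"
      using q_iff[OF i(2) j(2)] i(1) j(1) ne by auto
    then obtain k l where kl: "k \<in> {1..2*n}" "l \<in> {1..2*n}" "s k = s (nat i)" "s l = s (nat j)"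
        "\<bar>int k - int l\<bar> \<le> int (diameter n s)"
      using diameter_witness[OF s i(2) j(2)] by metis
    have "k = nat i \<or> k = q (nat i)" "l = nat j \<or> l = q (nat j)"
      using q_iff[OF i(2) kl(1)] q_iff[OF j(2) kl(2)] kl(3,4) by auto
    with kl(5) i(1) j(1)
    show "\<bar>i - j\<bar> < int (diameter n s + 1) \<or> \<bar>i - int (q (nat j))\<bar> < int (diameter n s + 1) \<or>
        \<bar>int (q (nat i)) - j\<bar> < int (diameter n s + 1) \<or>
        \<bar>int (q (nat i)) - int (q (nat j))\<bar> < int (diameter n s + 1)"
      by auto
  qed (use small in auto)
  show False by (rule inconsistent)
qed

section \<open>The minimum over all strings and the limit\<close>

text \<open>The value \<open>0\<close> outside the positions makes the set finite, so that the
  minimum in \<open>delta\<close> is attained.\<close>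

lemma finite_double_strings: "finite {s. double_string n s}"
proof (rule finite_subset)
  show "{s. double_string n s} \<subseteq>
      {s. \<forall>i. (i \<in> {1..2*n} \<longrightarrow> s i \<in> {1..n}) \<and> (i \<notin> {1..2*n} \<longrightarrow> s i = 0)}"
    by (auto simp: double_string_def)
qed (rule finite_set_of_finite_funs; simp)

lemma ex_double_string: "\<exists>s. double_string n s"
proof
  let ?s = "\<lambda>i. if i \<in> {1..n} then i else if i \<in> {n+1..2*n} then i - n else 0"
  have "{i\<in>{1..2*n}. ?s i = a} = {a, a + n}" if "a \<in> {1..n}" for a
    using that by (auto split: if_splits)
  then show "double_string n ?s"
    by (auto simp: double_string_def)
qed

lemma delta_bound: "8 * n < 23 * (delta n + 1)"
proof -
  have eq: "{diameter n s | s. double_string n s} = diameter n ` {s. double_string n s}"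
    by auto
  have "delta n \<in> {diameter n s | s. double_string n s}"
    unfolding delta_def eq using finite_double_strings ex_double_string by (intro Min_in) auto
  then show ?thesis using diameter_bound by auto
qed

theorem theorem3p6:
  shows "(\<forall>r::nat. r \<ge> 1 \<longrightarrow> delta (23 * r) \<ge> 8 * r) \<and>
         liminf (\<lambda>n. ereal (real (delta n) / real n)) \<ge> ereal (8 / 23)"
proof
  show "\<forall>r::nat. r \<ge> 1 \<longrightarrow> delta (23 * r) \<ge> 8 * r"
  proof (intro allI impI)
    fix r :: nat
    show "delta (23 * r) \<ge> 8 * r" using delta_bound[of "23 * r"] by simp
  qed
  \<comment> \<open>For \<open>n \<ge> 1\<close>, \<open>delta_bound\<close> gives
    \<open>delta n / n \<ge> 8 / 23 - 1 / n\<close>, with a vanishing error term.\<close>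
  have "(\<lambda>n. 8 / 23 - 1 / real n) \<longlonglongrightarrow> 8 / 23 - 0"
    by (intro tendsto_intros lim_1_over_n)
  then have "liminf (\<lambda>n. ereal (8 / 23 - 1 / real n)) = ereal (8 / 23)"
    by (intro lim_imp_Liminf) auto
  moreover have "liminf (\<lambda>n. ereal (8 / 23 - 1 / real n))
      \<le> liminf (\<lambda>n. ereal (real (delta n) / real n))"
  proof (intro Liminf_mono eventually_sequentiallyI[of 1])
    fix n :: nat assume "1 \<le> n"
    moreover have "real (8 * n) < real (23 * (delta n + 1))"
      using delta_bound[of n] by (simp only: of_nat_less_iff)
    ultimately have "(8 / 23 * real n - 1) / real n \<le> real (delta n) / real n"
      by (intro divide_right_mono) auto
    with \<open>1 \<le> n\<close> show "ereal (8 / 23 - 1 / real n) \<le> ereal (real (delta n) / real n)"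
      by (simp add: diff_divide_distrib)
  qed
  ultimately show "liminf (\<lambda>n. ereal (real (delta n) / real n)) \<ge> ereal (8 / 23)"
    by simp
qed

end
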